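(* Let $G=(V,E)$ be a directed graph with $n$ nodes and $m$ edges in which every node has out-degree at least $1$, let $d=m/n$, let $\alpha\in(0,1)$, and let the accuracy parameters $c,\beta$ of FAST-PPR be fixed constants. Given parameters $\delta>0$ and $\epsilon_r>0$, the running time of FAST-PPR$(s,t,\delta)$ with reverse threshold $\epsilon_r$, averaged over uniformly random pairs of nodes $(s,t)$ (and over the randomness of the algorithm), is $O\big(\alpha^{-1}(d/\epsilon_r+\epsilon_r/\delta)\big)$.
   Context: Notation: $\mathcal{N}^{in}(u)$, $\mathcal{N}^{out}(u)$, $d^{out}(u)$ denote in-neighbourhood, out-neighbourhood and out-degree. $Geom(\alpha)$ is the distribution on $\{0,1,2,\dots\}$ with $\mathbb{P}[L=i]=\alpha(1-\alpha)^i$; $RW(u,L)=\{u=V_0,V_1,\dots,V_L\}$ is the walk from $u$ that moves to a uniformly random out-neighbour at each step. The personalized PageRank is $\pi_u(v)=\mathbb{P}[V_L=v]$ with $L\sim Geom(\alpha)$, and $\pi^{-1}_t(w)=\pi_w(t)$. Procedure FRONTIER$(t,\epsilon_r,\beta)$: set $\epsilon_{inv}=\beta\epsilon_r$; initialise estimate vector $\widehat{\pi}^{-1}_t$ and residual vector $r_t$ to $0$ except $\widehat{\pi}^{-1}_t(t)=r_t(t)=\alpha$; set $\widehat T_t=\{t\}$, $\widehat F_t=\emptyset$. While some $w$ has $r_t(w)>\alpha\epsilon_{inv}$: for each $u\in\mathcal{N}^{in}(w)$, let $\Delta=(1-\alpha)r_t(w)/d^{out}(u)$, add $\Delta$ to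 both $\widehat{\pi}^{-1}_t(u)$ and $r_t(u)$, and if $\widehat{\pi}^{-1}_t(u)>\epsilon_r$ add $u$ to $\widehat T_t$ and add $\mathcal{N}^{in}(u)$ to $\widehat F_t$; then set $r_t(w)=0$. Finally set $\widehat F_t:=\widehat F_t\setminus\widehat T_t$ and return $\widehat T_t,\widehat F_t$ and the estimates. Algorithm FAST-PPR$(s,t,\delta)$ with reverse threshold $\epsilon_r$: run FRONTIER$(t,\epsilon_r,\beta)$. If $s\in\widehat T_t$ return $\widehat{\pi}^{-1}_t(s)$. Otherwise set $k=c\epsilon_r/\delta$; for $i=1,\dots,k$ draw independent $L_i\sim Geom(\alpha)$, generate $RW(s,L_i)$, and let $H_i$ be the first node of the walk in $\widehat F_t$ ($H_i=\bot$ if none, with $\widehat{\pi}^{-1}_t(\bot)=0$); return $\frac1k\sum_{i}\widehat{\pi}^{-1}_t(H_i)$. Running time counts elementary operations: each random-walk step costs $O(1)$ and each push in FRONTIER costs time proportional to the number of in-neighbours processed. *)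

theory Defs
  imports "Graph_Theory.Pair_Digraph" "HOL-Probability.Probability"
begin

definition out_nbs :: "'v pair_pre_digraph \<Rightarrow> 'v \<Rightarrow> 'v set" where
  "out_nbs G u = {v. (u, v) \<in> parcs G}"

definition in_nbs :: "'v pair_pre_digraph \<Rightarrow> 'v \<Rightarrow> 'v set" where
  "in_nbs G u = {v. (v, u) \<in> parcs G}"

text \<open>
  The list of visited nodes \<open>[V\<^sub>0, \<dots>, V\<^sub>L]\<close> of a walk with \<open>L\<close> steps.
\<close>

primrec random_walk :: "'v pair_pre_digraph \<Rightarrow> 'v \<Rightarrow> nat \<Rightarrow> 'v list pmf" where
  "random_walk G u 0 = return_pmf [u]"
| "random_walk G u (Suc L) =
     do {v \<leftarrow> pmf_of_set (out_nbs G u); vs \<leftarrow> random_walk G v L; return_pmf (u # vs)}"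

definition geometric_walk :: "'v pair_pre_digraph \<Rightarrow> real \<Rightarrow> 'v \<Rightarrow> 'v list pmf" where
  "geometric_walk G \<alpha> u = do {L \<leftarrow> geometric_pmf \<alpha>; random_walk G u L}"

text \<open>
  State of procedure FRONTIER. The field \<open>expanded\<close> does not influence the other variables of
  the procedure. It records the nodes \<open>u\<close> whose in-neighbourhood has already been
  added to the frontier: adding it again changes nothing, so \<open>ops\<close>, the number of
  elementary operations so far, is charged for it only the first time.
\<close>

record 'v frontier_state =
  est :: "'v \<Rightarrow> real"
  res :: "'v \<Rightarrow> real"
  targets :: "'v set"
  frontier :: "'v set"
  expanded :: "'v set"
  ops :: nat

definition frontier_init :: "real \<Rightarrow> 'v \<Rightarrow> 'v frontier_state" where
  "frontier_init \<alpha> t =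
     \<lparr>est = (\<lambda>v. if v = t then \<alpha> else 0), res = (\<lambda>v. if v = t then \<alpha> else 0),
      targets = {t}, frontier = {}, expanded = {}, ops = 0\<rparr>"

text \<open>
  Treatment of one in-neighbour \<open>u\<close> of \<open>w\<close>. The residual of \<open>w\<close> is read from the current state;
  it can change during the loop over the in-neighbours only if \<open>w\<close> has a self-loop.
\<close>

definition process_in_nb ::
    "'v pair_pre_digraph \<Rightarrow> real \<Rightarrow> real \<Rightarrow> 'v \<Rightarrow> 'v \<Rightarrow> 'v frontier_state \<Rightarrow> 'v frontier_state" where
  "process_in_nb G \<alpha> \<epsilon>\<^sub>r w u S =
     (let \<Delta> = (1 - \<alpha>) * res S w / real (out_degree (with_proj G) u);
          hit = (est S u + \<Delta> > \<epsilon>\<^sub>r)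
      in \<lparr>est = (est S)(u := est S u + \<Delta>),
          res = (res S)(u := res S u + \<Delta>),
          targets = (if hit then insert u (targets S) else targets S),
          frontier = (if hit then frontier S \<union> in_nbs G u else frontier S),
          expanded = (if hit then insert u (expanded S) else expanded S),
          ops = ops S + 1 + (if hit \<and> u \<notin> expanded S then card (in_nbs G u) else 0)\<rparr>)"

text \<open>
  A push of \<open>w\<close>, where \<open>us\<close> is the order in which its in-neighbours are enumerated.
  A push of a node without in-neighbours also costs one operation.
\<close>

definition push ::
    "'v pair_pre_digraph \<Rightarrow> real \<Rightarrow> real \<Rightarrow> 'v \<Rightarrow> 'v list \<Rightarrow> 'v frontier_state \<Rightarrow> 'v frontier_state" where
  "push G \<alpha> \<epsilon>\<^sub>r w us S =
     (let S' = fold (process_in_nb G \<alpha> \<epsilon>\<^sub>r w) us S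
      in S'\<lparr>res := (res S')(w := 0), ops := ops S' + 1\<rparr>)"

text \<open>
  One iteration of the while loop. It is a relation because the procedure fixes neither which
  node above the threshold is pushed nor the order of its in-neighbours.
\<close>

inductive frontier_step ::
    "'v pair_pre_digraph \<Rightarrow> real \<Rightarrow> real \<Rightarrow> real \<Rightarrow> 'v frontier_state \<Rightarrow> 'v frontier_state \<Rightarrow> bool"
  for G \<alpha> \<beta> \<epsilon>\<^sub>r where
  "\<lbrakk>w \<in> pverts G; res S w > \<alpha> * (\<beta> * \<epsilon>\<^sub>r); distinct us; set us = in_nbs G w\<rbrakk>
    \<Longrightarrow> frontier_step G \<alpha> \<beta> \<epsilon>\<^sub>r S (push G \<alpha> \<epsilon>\<^sub>r w us S)"

definition frontier_done ::
    "'v pair_pre_digraph \<Rightarrow> real \<Rightarrow> real \<Rightarrow> real \<Rightarrow> 'v frontier_state \<Rightarrow> bool" where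
  "frontier_done G \<alpha> \<beta> \<epsilon>\<^sub>r S \<longleftrightarrow> (\<forall>w\<in>pverts G. res S w \<le> \<alpha> * (\<beta> * \<epsilon>\<^sub>r))"

text \<open>
  The estimate at the first frontier node of a walk, \<open>0\<close> if there is none. The final
  frontier of FRONTIER is \<open>frontier S - targets S\<close>.
\<close>

definition hit_estimate :: "'v frontier_state \<Rightarrow> 'v list \<Rightarrow> real" where
  "hit_estimate S vs =
     (case find (\<lambda>v. v \<in> frontier S - targets S) vs of None \<Rightarrow> 0 | Some v \<Rightarrow> est S v)"

text \<open>
  The part of FAST-PPR after FRONTIER has ended in state \<open>S\<close>, with \<open>k\<close> walks: the joint
  distribution of the returned value and the total number of operations of the whole run.
  A walk costs one operation for each of its nodes, including the start node.
  The number of walks \<open>c * \<epsilon>\<^sub>r / \<delta>\<close> need not be an integer, so \<open>k\<close> is a rounding of it. Rounding down is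
  the literal reading of \<open>for i = 1, \<dots>, k\<close>. With rounding up there is always at least one walk, which
  already exceeds any bound of the form \<open>C * (d / \<epsilon>\<^sub>r + \<epsilon>\<^sub>r / \<delta>) / \<alpha>\<close> if \<open>\<epsilon>\<^sub>r\<close> and \<open>\<delta> / \<epsilon>\<^sub>r\<close> are both
  large; this cannot happen if one of the thresholds \<open>\<epsilon>\<^sub>r\<close> and \<open>\<delta>\<close> is at most \<open>1\<close>.
\<close>

definition fast_ppr_finish ::
    "'v pair_pre_digraph \<Rightarrow> real \<Rightarrow> nat \<Rightarrow> 'v \<Rightarrow> 'v frontier_state \<Rightarrow> (real \<times> nat) pmf" where
  "fast_ppr_finish G \<alpha> k s S =
     (if s \<in> targets S then return_pmf (est S s, ops S)
      else do {
        walks \<leftarrow> replicate_pmf k (geometric_walk G \<alpha> s);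
        return_pmf ((\<Sum>vs\<leftarrow>walks. hit_estimate S vs) / real k,
                    ops S + (\<Sum>vs\<leftarrow>walks. length vs))
      })"

text \<open>
  Expected running time of FAST-PPR on \<open>(s, t)\<close> in the worst case over the choices left open by
  the while loop. Unfinished states contribute the operations performed so far; as every push
  costs at least one operation, a non-terminating execution would give \<open>\<infinity>\<close>.
\<close>

definition fast_ppr_time ::
    "'v pair_pre_digraph \<Rightarrow> real \<Rightarrow> real \<Rightarrow> real \<Rightarrow> nat \<Rightarrow> 'v \<Rightarrow> 'v \<Rightarrow> ennreal" where
  "fast_ppr_time G \<alpha> \<beta> \<epsilon>\<^sub>r k s t =
     (SUP S \<in> {S. (frontier_step G \<alpha> \<beta> \<epsilon>\<^sub>r)\<^sup>*\<^sup>* (frontier_init \<alpha> t) S}.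
        if frontier_done G \<alpha> \<beta> \<epsilon>\<^sub>r S
        then \<integral>\<^sup>+ x. of_nat (snd x) \<partial>measure_pmf (fast_ppr_finish G \<alpha> k s S)
        else of_nat (ops S))"

definition fast_ppr_average_time ::
    "'v pair_pre_digraph \<Rightarrow> real \<Rightarrow> real \<Rightarrow> real \<Rightarrow> nat \<Rightarrow> ennreal" where
  "fast_ppr_average_time G \<alpha> \<beta> \<epsilon>\<^sub>r k =
     (\<integral>\<^sup>+ (s, t). fast_ppr_time G \<alpha> \<beta> \<epsilon>\<^sub>r k s t \<partial>measure_pmf (pmf_of_set (pverts G \<times> pverts G)))"

definition average_degree :: "'v pair_pre_digraph \<Rightarrow> real" where
  "average_degree G = real (card (parcs G)) / real (card (pverts G))"

end

theory Submission
  imports Defs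
begin

text \<open>
  For a target \<open>t\<close> the estimates satisfy the PageRank equation as an inequality: the estimate at \<open>v\<close>
  is at most \<open>\<alpha>\<close> (if \<open>v = t\<close>) plus \<open>1 - \<alpha>\<close> times its average over the out-neighbours of \<open>v\<close>. This
  inequality survives taking the supremum over all reachable states. Summing over \<open>t\<close> gives a
  function \<open>f\<close> with \<open>f \<le> \<alpha> + (1 - \<alpha>) P f\<close>, where \<open>P\<close> is the transition operator of the walk, and the
  maximum principle yields \<open>f \<le> 1\<close>; PageRank itself is never needed.

  Each push of \<open>w\<close> moves a residual larger than \<open>\<alpha> \<beta> \<epsilon>\<^sub>r\<close>, and the total residual moved out of \<open>w\<close> is at
  most its estimate. Hence \<open>w\<close> is pushed at most \<open>1 / (\<alpha> \<beta> \<epsilon>\<^sub>r)\<close> times, summed over all targets, and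
  by the same bound its in-neighbourhood enters the frontier for at most \<open>1 / \<epsilon>\<^sub>r\<close> targets. Weighting
  with in-degrees gives the reverse cost, and each forward walk visits \<open>1 / \<alpha>\<close> nodes in expectation.
\<close>

section \<open>Expected cost of the forward walks\<close>

lemma length_random_walk:
  "vs \<in> set_pmf (random_walk G u L) \<Longrightarrow> length vs = Suc L"
  by (induction L arbitrary: u vs) auto

lemma nn_integral_length_random_walk:
  "(\<integral>\<^sup>+vs. of_nat (length vs) \<partial>measure_pmf (random_walk G u L)) = of_nat (Suc L)"
proof -
  have "(\<integral>\<^sup>+vs. of_nat (length vs) \<partial>measure_pmf (random_walk G u L))
      = (\<integral>\<^sup>+vs. of_nat (Suc L) \<partial>measure_pmf (random_walk G u L))"
    by (intro nn_integral_cong_AE) (auto simp: AE_measure_pmf_iff length_random_walk)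
  then show ?thesis by simp
qed

text \<open>A walk of \<open>L\<close> steps has \<open>L + 1\<close> nodes, and \<open>L\<close>
  has mean \<open>(1 - \<alpha>) / \<alpha>\<close>; the two contributions add up to
  \<open>1 / \<alpha>\<close>.\<close>

lemma nn_integral_length_geometric_walk:
  assumes "0 < \<alpha>" "\<alpha> < 1"
  shows "(\<integral>\<^sup>+vs. of_nat (length vs) \<partial>measure_pmf (geometric_walk G \<alpha> u)) = ennreal (1 / \<alpha>)"
proof -
  have i: "integrable (geometric_pmf \<alpha>) real"
    and e: "measure_pmf.expectation (geometric_pmf \<alpha>) real = (1 - \<alpha>) / \<alpha>"
    using assms by (auto intro!: integrable_real_geometric_pmf expectation_geometric_pmf)
  have "(\<integral>\<^sup>+L. of_nat L \<partial>measure_pmf (geometric_pmf \<alpha>))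
      = (\<integral>\<^sup>+L. ennreal (real L) \<partial>measure_pmf (geometric_pmf \<alpha>))"
    by (simp add: ennreal_of_nat_eq_real_of_nat)
  also have "\<dots> = ennreal ((1 - \<alpha>) / \<alpha>)"
    using i e by (subst nn_integral_eq_integral) auto
  finally have L: "(\<integral>\<^sup>+L. of_nat L \<partial>measure_pmf (geometric_pmf \<alpha>)) = ennreal ((1 - \<alpha>) / \<alpha>)" .
  have "(\<integral>\<^sup>+vs. of_nat (length vs) \<partial>measure_pmf (geometric_walk G \<alpha> u))
      = (\<integral>\<^sup>+L. 1 + of_nat L \<partial>measure_pmf (geometric_pmf \<alpha>))"
    by (simp add: geometric_walk_def nn_integral_length_random_walk)
  also have "\<dots> = 1 + ennreal ((1 - \<alpha>) / \<alpha>)"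
    by (subst nn_integral_add) (auto simp: L)
  also have "\<dots> = ennreal (1 + (1 - \<alpha>) / \<alpha>)"
    using assms by (subst ennreal_plus) auto
  also have "1 + (1 - \<alpha>) / \<alpha> = 1 / \<alpha>"
    using assms by (simp add: field_simps)
  finally show ?thesis .
qed

lemma nn_integral_sum_list_replicate_pmf:
  fixes f :: "'a \<Rightarrow> nat"
  shows "(\<integral>\<^sup>+xs. of_nat (\<Sum>x\<leftarrow>xs. f x) \<partial>measure_pmf (replicate_pmf k p))
    = of_nat k * (\<integral>\<^sup>+x. of_nat (f x) \<partial>measure_pmf p)"
  by (induction k) (simp_all add: nn_integral_add algebra_simps)

lemma nn_integral_fast_ppr_finish_le:
  assumes "0 < \<alpha>" "\<alpha> < 1"
  shows "(\<integral>\<^sup>+x. of_nat (snd x) \<partial>measure_pmf (fast_ppr_finish G \<alpha> k s S))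
    \<le> of_nat (ops S) + ennreal (real k / \<alpha>)"
proof (cases "s \<in> targets S")
  case False
  have "(\<integral>\<^sup>+x. of_nat (snd x) \<partial>measure_pmf (fast_ppr_finish G \<alpha> k s S))
      = of_nat (ops S) + (\<integral>\<^sup>+vss. of_nat (\<Sum>vs\<leftarrow>vss. length vs)
          \<partial>measure_pmf (replicate_pmf k (geometric_walk G \<alpha> s)))"
    using False by (simp add: fast_ppr_finish_def nn_integral_add)
  also have "\<dots> = of_nat (ops S) + of_nat k * ennreal (1 / \<alpha>)"
    using assms
    by (simp only: nn_integral_sum_list_replicate_pmf nn_integral_length_geometric_walk)
  also have "of_nat k * ennreal (1 / \<alpha>) = ennreal (real k / \<alpha>)"
    using assms by (simp add: ennreal_of_nat_eq_real_of_nat ennreal_mult[symmetric])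
  finally show ?thesis by simp
qed (simp add: fast_ppr_finish_def)

section \<open>Neighbourhoods and degree sums\<close>

context pair_fin_digraph
begin

lemma finite_out_nbs: "finite (out_nbs G v)" and finite_in_nbs: "finite (in_nbs G v)"
  and out_nbs_subset: "out_nbs G v \<subseteq> pverts G" and in_nbs_subset: "in_nbs G v \<subseteq> pverts G"
proof -
  show "out_nbs G v \<subseteq> pverts G" "in_nbs G v \<subseteq> pverts G"
    unfolding out_nbs_def in_nbs_def using wellformed' by auto
  then show "finite (out_nbs G v)" "finite (in_nbs G v)"
    using pair_finite_verts finite_subset by blast+
qed

lemma out_degree_eq_card_out_nbs: "out_degree (with_proj G) v = card (out_nbs G v)"
proof -
  have "bij_betw snd (out_arcs (with_proj G) v) (out_nbs G v)"
    unfolding bij_betw_def by (force simp: inj_on_def out_arcs_def out_nbs_def image_iff)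
  then show ?thesis
    unfolding out_degree_def by (rule bij_betw_same_card)
qed

lemma sum_card_in_nbs: "(\<Sum>w\<in>pverts G. card (in_nbs G w)) = card (parcs G)"
proof -
  have *: "(parcs G)\<inverse> = Sigma (pverts G) (in_nbs G)"
    using wellformed' by (auto simp: in_nbs_def)
  have "card (parcs G) = card (Sigma (pverts G) (in_nbs G))"
    using card_inverse[of "parcs G"] * by simp
  also have "\<dots> = (\<Sum>w\<in>pverts G. card (in_nbs G w))"
    by (rule card_SigmaI) (auto simp: pair_finite_verts finite_in_nbs)
  finally show ?thesis ..
qed

lemma sum_card_out_nbs: "(\<Sum>v\<in>pverts G. card (out_nbs G v)) = card (parcs G)"
proof -
  have "parcs G = Sigma (pverts G) (out_nbs G)"
    using wellformed' by (auto simp: out_nbs_def)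
  then show ?thesis
    using card_SigmaI[of "pverts G" "out_nbs G"] pair_finite_verts finite_out_nbs by simp
qed

text \<open>Every push costs one operation on top of the in-degree; this bound absorbs the resulting
  vertex count into the arc count.\<close>

lemma card_verts_le_card_arcs:
  assumes "\<And>v. v \<in> pverts G \<Longrightarrow> out_degree (with_proj G) v \<ge> 1"
  shows "card (pverts G) \<le> card (parcs G)"
proof -
  have "(\<Sum>v\<in>pverts G. 1) \<le> (\<Sum>v\<in>pverts G. card (out_nbs G v))"
    using assms by (intro sum_mono) (simp add: out_degree_eq_card_out_nbs)
  then show ?thesis by (simp add: sum_card_out_nbs)
qed

section \<open>Transition operator and maximum principle\<close>

text \<open>The transition operator of the walk. Division by zero makes it \<open>0\<close> at a
  vertex without out-neighbours, hence the assumption \<open>0 \<le> M\<close> in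
  \<open>out_average_le\<close>.\<close>

definition out_average :: "('a \<Rightarrow> real) \<Rightarrow> 'a \<Rightarrow> real" where
  "out_average f v = (\<Sum>w\<in>out_nbs G v. f w) / real (card (out_nbs G v))"

lemma out_average_mono:
  assumes "\<And>w. w \<in> out_nbs G v \<Longrightarrow> f w \<le> g w"
  shows "out_average f v \<le> out_average g v"
  unfolding out_average_def by (intro divide_right_mono sum_mono assms) auto

lemma out_average_le:
  assumes "\<And>w. w \<in> pverts G \<Longrightarrow> f w \<le> M" and "0 \<le> M"
  shows "out_average f v \<le> M"
proof (cases "out_nbs G v = {}")
  case False
  have "(\<Sum>w\<in>out_nbs G v. f w) \<le> real (card (out_nbs G v)) * M"
    using assms out_nbs_subset by (intro sum_bounded_above) auto
  moreover have "card (out_nbs G v) > 0"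
    using False finite_out_nbs card_gt_0_iff by blast
  ultimately show ?thesis
    by (simp add: out_average_def divide_le_eq mult.commute)
qed (use assms in \<open>simp add: out_average_def\<close>)

lemma out_average_sum:
  "out_average (\<lambda>w. \<Sum>t\<in>T. f t w) v = (\<Sum>t\<in>T. out_average (f t) v)"
  unfolding out_average_def by (subst sum.swap) (simp add: sum_divide_distrib)

text \<open>An average does not exceed the maximum \<open>M\<close>, so
  \<open>M \<le> \<alpha> + (1 - \<alpha>) * M\<close>; solving for \<open>M\<close> gives
  \<open>M \<le> 1\<close>.\<close>

lemma maximum_principle:
  assumes "0 < \<alpha>" "\<alpha> < 1"
    and f: "\<And>v. v \<in> pverts G \<Longrightarrow> f v \<le> \<alpha> + (1 - \<alpha>) * out_average f v"
    and v: "v \<in> pverts G"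
  shows "f v \<le> 1"
proof -
  \<comment> \<open>Including \<open>0\<close> makes \<open>M\<close> nonnegative, as
    \<open>out_average_le\<close> demands; the extra element also lies below
    \<open>\<alpha> + (1 - \<alpha>) * M\<close>.\<close>
  define M where "M = Max (insert 0 (f ` pverts G))"
  have fin: "finite (insert 0 (f ` pverts G))"
    using pair_finite_verts by simp
  have M: "0 \<le> M" "w \<in> pverts G \<Longrightarrow> f w \<le> M" for w
    unfolding M_def using fin by auto
  have "f w \<le> \<alpha> + (1 - \<alpha>) * M" if "w \<in> pverts G" for w
  proof -
    have "(1 - \<alpha>) * out_average f w \<le> (1 - \<alpha>) * M"
      using M assms(2) by (intro mult_left_mono out_average_le) auto
    with f[OF that] show ?thesis by linarith
  qed
  moreover have "0 \<le> \<alpha> + (1 - \<alpha>) * M"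
    using M assms by simp
  ultimately have "M \<le> \<alpha> + (1 - \<alpha>) * M"
    unfolding M_def using fin by (subst Max_le_iff) (auto simp: M_def)
  then have "\<alpha> * M \<le> \<alpha> * 1"
    by (simp add: algebra_simps)
  then have "M \<le> 1"
    using assms(1) by (simp only: mult_le_cancel_left_pos)
  with M(2)[OF v] show ?thesis by simp
qed

end

section \<open>Invariant of the frontier procedure\<close>

locale frontier_procedure = pair_fin_digraph G for G :: "'v pair_pre_digraph" +
  fixes \<alpha> \<beta> \<epsilon>\<^sub>r :: real
  assumes out_degree_pos: "v \<in> pverts G \<Longrightarrow> out_degree (with_proj G) v \<ge> 1"
    and alpha: "0 < \<alpha>" "\<alpha> < 1" and beta: "0 < \<beta>" and eps: "0 < \<epsilon>\<^sub>r"
begin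

text \<open>
  The last conclusion bounds the increment at \<open>u\<close> by the final residual of \<open>w\<close>: a self-loop
  raises that residual during the loop.
\<close>

lemma fold_process_in_nb:
  assumes "distinct us" and "0 \<le> res S w"
  defines "S' \<equiv> fold (process_in_nb G \<alpha> \<epsilon>\<^sub>r w) us S"
  shows "(\<forall>v. est S' v - res S' v = est S v - res S v) \<and> (\<forall>v. est S v \<le> est S' v) \<and>
    (\<forall>v. v \<notin> set us \<longrightarrow> est S' v = est S v) \<and>
    (\<forall>u\<in>set us. est S' u \<le> est S u + (1 - \<alpha>) * res S' w / real (card (out_nbs G u)))"
  using assms(1,2) unfolding S'_def
proof (induction us arbitrary: S)
  case (Cons x us)
  define D where "D = (1 - \<alpha>) * res S w / real (card (out_nbs G x))"
  define T where "T = process_in_nb G \<alpha> \<epsilon>\<^sub>r w x S"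
  define T' where "T' = fold (process_in_nb G \<alpha> \<epsilon>\<^sub>r w) us T"
  have T: "est T = (est S)(x := est S x + D)" "res T = (res S)(x := res S x + D)"
    by (simp_all add: T_def D_def process_in_nb_def Let_def out_degree_eq_card_out_nbs)
  have D: "0 \<le> D"
    using Cons.prems alpha by (simp add: D_def)
  have "0 \<le> res T w"
    using Cons.prems D T by (cases "w = x") auto
  with Cons.IH[of T] Cons.prems have IH:
    "\<And>v. est T' v - res T' v = est T v - res T v" "\<And>v. est T v \<le> est T' v"
    "\<And>v. v \<notin> set us \<Longrightarrow> est T' v = est T v"
    "\<And>u. u \<in> set us \<Longrightarrow> est T' u \<le> est T u + (1 - \<alpha>) * res T' w / real (card (out_nbs G u))"
    by (auto simp: T'_def)
  \<comment> \<open>The rest of the loop preserves the difference of estimate and residual and never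
    lowers an estimate, so the residual at \<open>w\<close> does not decrease. Hence
    \<open>D\<close>, computed from the current residual, is bounded in terms of the final
    one.\<close>
  have "res S w \<le> res T w"
    using D T by simp
  also have "\<dots> \<le> res T' w"
    using IH(1)[of w] IH(2)[of w] by linarith
  finally have "D \<le> (1 - \<alpha>) * res T' w / real (card (out_nbs G x))"
    unfolding D_def using alpha by (intro divide_right_mono mult_left_mono) auto
  moreover have "est T' x = est S x + D"
    using IH(3)[of x] Cons.prems T by simp
  moreover have "est T u = est S u" if "u \<in> set us" for u
    using that Cons.prems T by auto
  moreover have "est S v \<le> est T' v" for v
    using IH(2)[of v] D T by (cases "v = x") auto
  moreover have "est T' v - res T' v = est S v - res S v" for v
    using IH(1)[of v] T by (cases "v = x") auto
  moreover have "est T' v = est S v" if "v \<notin> set (x # us)" for v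
    using that IH(3)[of v] T by auto
  ultimately have "(\<forall>v. est T' v - res T' v = est S v - res S v) \<and> (\<forall>v. est S v \<le> est T' v) \<and>
    (\<forall>v. v \<notin> set (x # us) \<longrightarrow> est T' v = est S v) \<and>
    (\<forall>u\<in>set (x # us). est T' u \<le> est S u + (1 - \<alpha>) * res T' w / real (card (out_nbs G u)))"
    using IH(4) by fastforce
  then show ?case
    by (simp add: T_def T'_def)
qed simp

text \<open>The share of \<open>ops\<close> spent on enlarging the frontier. It is a function of the
  state because a node is charged only once, when it enters \<open>expanded\<close>.\<close>

definition expansion_cost :: "'v frontier_state \<Rightarrow> nat" where
  "expansion_cost S = (\<Sum>u\<in>expanded S. card (in_nbs G u))"

text \<open>Apart from expansions, each in-neighbour costs one operation; the balance is written
  additively to avoid subtraction on \<open>nat\<close>. A node enters \<open>expanded\<close> only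
  when its updated estimate exceeds the threshold, and later steps never lower that
  estimate.\<close>

lemma fold_process_in_nb_ops:
  assumes "0 \<le> res S w" "distinct us" "finite (expanded S)" "\<And>u. u \<in> expanded S \<Longrightarrow> \<epsilon>\<^sub>r < est S u"
  defines "S' \<equiv> fold (process_in_nb G \<alpha> \<epsilon>\<^sub>r w) us S"
  shows "ops S' + expansion_cost S = ops S + length us + expansion_cost S' \<and>
    finite (expanded S') \<and> expanded S' \<subseteq> expanded S \<union> set us \<and> (\<forall>u\<in>expanded S'. \<epsilon>\<^sub>r < est S' u)"
  using assms(1-4) unfolding S'_def
proof (induction us arbitrary: S)
  case (Cons x us)
  define T where "T = process_in_nb G \<alpha> \<epsilon>\<^sub>r w x S"
  define T' where "T' = fold (process_in_nb G \<alpha> \<epsilon>\<^sub>r w) us T"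
  have 1: "T = fold (process_in_nb G \<alpha> \<epsilon>\<^sub>r w) [x] S"
    by (simp add: T_def)
  have mono: "est S v \<le> est T v" "est T v - res T v = est S v - res S v" for v
    using fold_process_in_nb[of "[x]" S w] Cons.prems(1) unfolding 1 by auto
  have ops: "ops T + expansion_cost S = ops S + 1 + expansion_cost T"
    using Cons.prems(3)
    by (auto simp: T_def process_in_nb_def Let_def expansion_cost_def insert_absorb)
  have exp: "expanded T \<subseteq> insert x (expanded S)" "finite (expanded T)"
    using Cons.prems(3) by (auto simp: T_def process_in_nb_def Let_def split: if_splits)
  have "\<epsilon>\<^sub>r < est T x" if "x \<in> expanded T" "x \<notin> expanded S"
    using that by (auto simp: T_def process_in_nb_def Let_def split: if_splits)
  then have hit: "\<epsilon>\<^sub>r < est T u" if "u \<in> expanded T" for u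
    using that exp Cons.prems(4)[of u] mono(1)[of u] by fastforce
  have "0 \<le> res T w"
    using mono[of w] Cons.prems(1) by linarith
  with Cons.IH[of T] Cons.prems(2) exp hit
  have IH: "ops T' + expansion_cost T = ops T + length us + expansion_cost T'" "finite (expanded T')"
    "expanded T' \<subseteq> expanded T \<union> set us" "\<forall>u\<in>expanded T'. \<epsilon>\<^sub>r < est T' u"
    by (auto simp: T'_def)
  have "ops T' + expansion_cost S = ops S + length (x # us) + expansion_cost T'"
    using IH(1) ops by simp
  moreover have "expanded T' \<subseteq> expanded S \<union> set (x # us)"
    using IH(3) exp by auto
  ultimately show ?case
    using IH(2,4) by (simp add: T_def T'_def)
qed simp

text \<open>
  The difference of \<open>est S w\<close> and \<open>res S w\<close> is the total residual pushed out of \<open>w\<close> so far,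
  including what a self-loop of \<open>w\<close> has lost. Each push of \<open>w\<close> adds more than
  \<open>\<alpha> * (\<beta> * \<epsilon>\<^sub>r)\<close> to it.
\<close>

definition frontier_inv :: "'v \<Rightarrow> 'v frontier_state \<Rightarrow> bool" where
  "frontier_inv t S \<longleftrightarrow>
     (\<forall>v. 0 \<le> res S v \<and> res S v \<le> est S v) \<and>
     (\<forall>v\<in>pverts G. est S v \<le>
        (if v = t then \<alpha> else 0) + (1 - \<alpha>) * out_average (\<lambda>w. est S w - res S w) v) \<and>
     expanded S \<subseteq> pverts G \<and> (\<forall>u\<in>expanded S. \<epsilon>\<^sub>r < est S u) \<and>
     real (ops S) \<le>
       (\<Sum>w\<in>pverts G. real (card (in_nbs G w) + 1) * ((est S w - res S w) / (\<alpha> * (\<beta> * \<epsilon>\<^sub>r)))) +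
       real (expansion_cost S)"

text \<open>Estimate and residual coincide at the start, so no mass has been pushed and only the
  term \<open>\<alpha>\<close> at \<open>t\<close> remains.\<close>

lemma frontier_inv_init: "frontier_inv t (frontier_init \<alpha> t)"
  using alpha
  by (auto simp: frontier_inv_def frontier_init_def out_average_def expansion_cost_def
      intro!: sum_nonneg)

text \<open>Setting the residual of \<open>w\<close> to \<open>0\<close> turns its last value into
  pushed mass at \<open>w\<close>. The average of the pushed mass at an in-neighbour
  \<open>u\<close> grows by this value divided by the out-degree of \<open>u\<close>, which after
  scaling by \<open>1 - \<alpha>\<close> covers the growth of the estimate at \<open>u\<close>. The
  same mass pays for the operations.\<close>

lemma frontier_inv_push:
  assumes inv: "frontier_inv t S" and w: "w \<in> pverts G" and res: "\<alpha> * (\<beta> * \<epsilon>\<^sub>r) < res S w"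
    and us: "distinct us" "set us = in_nbs G w"
  shows "frontier_inv t (push G \<alpha> \<epsilon>\<^sub>r w us S)"
proof -
  define S' where "S' = fold (process_in_nb G \<alpha> \<epsilon>\<^sub>r w) us S"
  define T where "T = push G \<alpha> \<epsilon>\<^sub>r w us S"
  define q where "q = (\<lambda>v. est S v - res S v)"
  define q' where "q' = (\<lambda>v. est T v - res T v)"
  have T: "est T = est S'" "res T = (res S')(w := 0)" "expanded T = expanded S'"
    "ops T = ops S' + 1" "expansion_cost T = expansion_cost S'"
    by (simp_all add: T_def push_def S'_def Let_def expansion_cost_def)
  have S: "\<And>v. 0 \<le> res S v" "\<And>v. res S v \<le> est S v"
    "\<And>v. v \<in> pverts G \<Longrightarrow> est S v \<le> (if v = t then \<alpha> else 0) + (1 - \<alpha>) * out_average q v"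
    "expanded S \<subseteq> pverts G" "\<And>u. u \<in> expanded S \<Longrightarrow> \<epsilon>\<^sub>r < est S u"
    "real (ops S) \<le>
       (\<Sum>w\<in>pverts G. real (card (in_nbs G w) + 1) * (q w / (\<alpha> * (\<beta> * \<epsilon>\<^sub>r)))) + real (expansion_cost S)"
    using inv by (auto simp: frontier_inv_def q_def)
  have fin: "finite (expanded S)"
    using S(4) pair_finite_verts finite_subset by blast
  note est' = fold_process_in_nb[OF us(1) S(1)[of w], folded S'_def]
  have diff: "\<And>v. est S' v - res S' v = q v" and mono: "\<And>v. est S v \<le> est S' v"
    and same: "\<And>v. v \<notin> in_nbs G w \<Longrightarrow> est S' v = est S v"
    and incr: "\<And>u. u \<in> in_nbs G w \<Longrightarrow>
      est S' u \<le> est S u + (1 - \<alpha>) * res S' w / real (card (out_nbs G u))"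
    using est' by (auto simp: us(2) q_def)
  note ops' = fold_process_in_nb_ops[OF S(1)[of w] us(1) fin S(5), folded S'_def]
  have res_mono: "res S v \<le> res S' v" for v
    using diff[of v] mono[of v] by (simp add: q_def)
  have pushed: "q' = (\<lambda>v. q v + (if v = w then res S' w else 0))"
  proof
    fix v
    show "q' v = q v + (if v = w then res S' w else 0)"
      using diff[of v] by (auto simp: q'_def T)
  qed
  have avg: "out_average q' v = out_average q v +
      (if v \<in> in_nbs G w then res S' w / real (card (out_nbs G v)) else 0)" for v
  proof -
    have "(\<Sum>x\<in>out_nbs G v. q' x) = (\<Sum>x\<in>out_nbs G v. q x) + (if w \<in> out_nbs G v then res S' w else 0)"
      unfolding pushed using finite_out_nbs by (simp add: sum.distrib)
    then show ?thesis
      by (auto simp: out_average_def add_divide_distrib in_nbs_def out_nbs_def)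
  qed
  have "est T v \<le> (if v = t then \<alpha> else 0) + (1 - \<alpha>) * out_average q' v" if "v \<in> pverts G" for v
  proof (cases "v \<in> in_nbs G w")
    case True
    then show ?thesis
      using S(3)[OF that] incr[of v] by (simp add: avg T distrib_left)
  next
    case False
    then show ?thesis
      using S(3)[OF that] same[of v] by (simp add: avg T)
  qed
  moreover have "0 \<le> res T v \<and> res T v \<le> est T v" for v
    using S(1,2)[of v] res_mono[of v] mono[of v] diff[of v] by (auto simp: T q_def)
  moreover have "expanded T \<subseteq> pverts G"
    using ops' S(4) in_nbs_subset[of w] us(2) T by auto
  moreover have "\<forall>u\<in>expanded T. \<epsilon>\<^sub>r < est T u"
    using ops' by (auto simp: T)
  moreover have "real (ops T) \<le>
    (\<Sum>v\<in>pverts G. real (card (in_nbs G v) + 1) * (q' v / (\<alpha> * (\<beta> * \<epsilon>\<^sub>r)))) + real (expansion_cost T)"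
  proof -
    have pos: "0 < \<alpha> * (\<beta> * \<epsilon>\<^sub>r)"
      using alpha beta eps by simp
    \<comment> \<open>The mass pushed now, in units of the threshold, is at least \<open>1\<close>.
      With weight \<open>card (in_nbs G w) + 1\<close> it covers one operation per in-neighbour and
      one for the push itself.\<close>
    have "1 \<le> res S' w / (\<alpha> * (\<beta> * \<epsilon>\<^sub>r))"
      using res res_mono[of w] pos by (simp add: le_divide_eq)
    then have "real (card (in_nbs G w) + 1) * 1
        \<le> real (card (in_nbs G w) + 1) * (res S' w / (\<alpha> * (\<beta> * \<epsilon>\<^sub>r)))"
      by (intro mult_left_mono) auto
    moreover have "(\<Sum>v\<in>pverts G. real (card (in_nbs G v) + 1) * (q' v / (\<alpha> * (\<beta> * \<epsilon>\<^sub>r))))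
      = (\<Sum>v\<in>pverts G. real (card (in_nbs G v) + 1) * (q v / (\<alpha> * (\<beta> * \<epsilon>\<^sub>r))) +
          (if v = w then real (card (in_nbs G w) + 1) * (res S' w / (\<alpha> * (\<beta> * \<epsilon>\<^sub>r))) else 0))"
      unfolding pushed by (intro sum.cong) (auto simp: add_divide_distrib distrib_left)
    then have "(\<Sum>v\<in>pverts G. real (card (in_nbs G v) + 1) * (q' v / (\<alpha> * (\<beta> * \<epsilon>\<^sub>r))))
      = (\<Sum>v\<in>pverts G. real (card (in_nbs G v) + 1) * (q v / (\<alpha> * (\<beta> * \<epsilon>\<^sub>r)))) +
          real (card (in_nbs G w) + 1) * (res S' w / (\<alpha> * (\<beta> * \<epsilon>\<^sub>r)))"
      using w pair_finite_verts by (simp only: sum.distrib sum.delta if_True)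
    moreover have "real (ops T) + real (expansion_cost S)
        = real (ops S) + real (card (in_nbs G w) + 1) + real (expansion_cost T)"
      using ops' us distinct_card[of us] by (simp add: T)
    ultimately show ?thesis
      using S(6) by simp
  qed
  ultimately show ?thesis
    unfolding frontier_inv_def T_def[symmetric] q'_def by blast
qed

section \<open>Estimates maximised over all executions\<close>

definition reachable :: "'v \<Rightarrow> 'v frontier_state set" where
  "reachable t = {S. (frontier_step G \<alpha> \<beta> \<epsilon>\<^sub>r)\<^sup>*\<^sup>* (frontier_init \<alpha> t) S}"

lemma init_in_reachable: "frontier_init \<alpha> t \<in> reachable t"
  by (simp add: reachable_def)

lemma frontier_inv_reachable:
  assumes "S \<in> reachable t"
  shows "frontier_inv t S"
proof -
  have "(frontier_step G \<alpha> \<beta> \<epsilon>\<^sub>r)\<^sup>*\<^sup>* (frontier_init \<alpha> t) S"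
    using assms by (simp add: reachable_def)
  then show ?thesis
    by (induction rule: rtranclp_induct)
       (auto simp: frontier_inv_init frontier_inv_push elim!: frontier_step.cases)
qed

text \<open>Residuals are nonnegative, so replacing pushed mass by the estimate only enlarges the
  average. The inequality then involves estimates alone and can pass to a supremum.\<close>

lemma est_reachable_subharmonic:
  assumes "S \<in> reachable t" "v \<in> pverts G"
  shows "est S v \<le> (if v = t then \<alpha> else 0) + (1 - \<alpha>) * out_average (est S) v"
proof -
  have inv: "frontier_inv t S"
    using assms frontier_inv_reachable by blast
  have "out_average (\<lambda>w. est S w - res S w) v \<le> out_average (est S) v"
    using inv by (intro out_average_mono) (auto simp: frontier_inv_def)
  then have "(1 - \<alpha>) * out_average (\<lambda>w. est S w - res S w) v \<le> (1 - \<alpha>) * out_average (est S) v"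
    using alpha by (intro mult_left_mono) auto
  moreover have "est S v \<le> (if v = t then \<alpha> else 0) + (1 - \<alpha>) * out_average (\<lambda>w. est S w - res S w) v"
    using inv assms(2) by (simp add: frontier_inv_def)
  ultimately show ?thesis by linarith
qed

lemma est_reachable_le_1:
  assumes "S \<in> reachable t" "v \<in> pverts G"
  shows "est S v \<le> 1"
proof (rule maximum_principle[OF alpha _ assms(2)])
  show "est S v \<le> \<alpha> + (1 - \<alpha>) * out_average (est S) v" if "v \<in> pverts G" for v
    using est_reachable_subharmonic[OF assms(1) that] alpha by (auto split: if_splits)
qed

text \<open>One bound for all executions, whatever choices the loop makes. The real supremum is
  meaningful at vertices by \<open>est_reachable_le_1\<close>.\<close>

definition max_est :: "'v \<Rightarrow> 'v \<Rightarrow> real" where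
  "max_est t v = (SUP S\<in>reachable t. est S v)"

lemma est_le_max_est: "S \<in> reachable t \<Longrightarrow> v \<in> pverts G \<Longrightarrow> est S v \<le> max_est t v"
  unfolding max_est_def by (rule cSUP_upper) (auto intro!: bdd_aboveI[of _ 1] est_reachable_le_1)

lemma max_est_nonneg:
  assumes "v \<in> pverts G"
  shows "0 \<le> max_est t v"
proof -
  have "0 \<le> est (frontier_init \<alpha> t) v"
    using alpha by (simp add: frontier_init_def)
  also have "\<dots> \<le> max_est t v"
    by (rule est_le_max_est[OF init_in_reachable assms])
  finally show ?thesis .
qed

text \<open>The right-hand side of the inequality for one target is monotone in the estimates, so
  the inequality holds for the supremum too. Summing over \<open>t\<close> yields
  \<open>\<alpha>\<close> only once, from \<open>t = v\<close>, and the maximum principle applies to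
  the sum.\<close>

lemma sum_max_est_le_1:
  assumes "v \<in> pverts G"
  shows "(\<Sum>t\<in>pverts G. max_est t v) \<le> 1"
proof (rule maximum_principle[OF alpha _ assms])
  fix v assume v: "v \<in> pverts G"
  have "max_est t v \<le> (if v = t then \<alpha> else 0) + (1 - \<alpha>) * out_average (max_est t) v" for t
    unfolding max_est_def[of t v]
  proof (rule cSUP_least)
    fix S assume S: "S \<in> reachable t"
    have "out_average (est S) v \<le> out_average (max_est t) v"
      using S out_nbs_subset by (intro out_average_mono) (auto intro!: est_le_max_est)
    then have "(1 - \<alpha>) * out_average (est S) v \<le> (1 - \<alpha>) * out_average (max_est t) v"
      using alpha by (intro mult_left_mono) auto
    then show "est S v \<le> (if v = t then \<alpha> else 0) + (1 - \<alpha>) * out_average (max_est t) v"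
      using est_reachable_subharmonic[OF S v] by linarith
  qed (use init_in_reachable in auto)
  then have "(\<Sum>t\<in>pverts G. max_est t v)
      \<le> (\<Sum>t\<in>pverts G. (if v = t then \<alpha> else 0) + (1 - \<alpha>) * out_average (max_est t) v)"
    by (intro sum_mono)
  also have "\<dots> = \<alpha> + (1 - \<alpha>) * out_average (\<lambda>w. \<Sum>t\<in>pverts G. max_est t w) v"
    using v pair_finite_verts by (simp add: sum.distrib out_average_sum sum_distrib_left)
  finally show "(\<Sum>t\<in>pverts G. max_est t v)
      \<le> \<alpha> + (1 - \<alpha>) * out_average (\<lambda>w. \<Sum>t\<in>pverts G. max_est t w) v" .
qed

section \<open>Reverse cost summed over all targets\<close>

text \<open>The first coefficient of \<open>max_est t w\<close> pays for the pushes of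
  \<open>w\<close>, the second for adding its in-neighbourhood to the frontier.\<close>

definition frontier_cost :: "'v \<Rightarrow> real" where
  "frontier_cost t =
     (\<Sum>w\<in>pverts G. (real (card (in_nbs G w) + 1) / (\<alpha> * (\<beta> * \<epsilon>\<^sub>r)) + real (card (in_nbs G w)) / \<epsilon>\<^sub>r) *
        max_est t w)"

lemma frontier_cost_nonneg: "0 \<le> frontier_cost t"
  unfolding frontier_cost_def using alpha beta eps
  by (intro sum_nonneg mult_nonneg_nonneg max_est_nonneg) auto

lemma ops_reachable_le:
  assumes S: "S \<in> reachable t"
  shows "real (ops S) \<le> frontier_cost t"
proof -
  have inv: "frontier_inv t S"
    by (rule frontier_inv_reachable[OF S])
  have pos: "0 < \<alpha> * (\<beta> * \<epsilon>\<^sub>r)"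
    using alpha beta eps by simp
  have "real (expansion_cost S) = (\<Sum>u\<in>expanded S. real (card (in_nbs G u)))"
    by (simp add: expansion_cost_def)
  \<comment> \<open>The estimate of an expanded node is above the threshold, so
    \<open>max_est t u / \<epsilon>\<^sub>r\<close> exceeds \<open>1\<close> and may be inserted as
    a factor.\<close>
  also have "\<dots> \<le> (\<Sum>u\<in>expanded S. real (card (in_nbs G u)) / \<epsilon>\<^sub>r * max_est t u)"
  proof (rule sum_mono)
    fix u assume u: "u \<in> expanded S"
    then have "\<epsilon>\<^sub>r < est S u" "est S u \<le> max_est t u"
      using inv est_le_max_est[OF S] by (auto simp: frontier_inv_def)
    then have "real (card (in_nbs G u)) * \<epsilon>\<^sub>r \<le> real (card (in_nbs G u)) * max_est t u"
      by (intro mult_left_mono) auto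
    then show "real (card (in_nbs G u)) \<le> real (card (in_nbs G u)) / \<epsilon>\<^sub>r * max_est t u"
      using eps by (simp add: field_simps)
  qed
  also have "\<dots> \<le> (\<Sum>u\<in>pverts G. real (card (in_nbs G u)) / \<epsilon>\<^sub>r * max_est t u)"
    using inv pair_finite_verts eps
    by (intro sum_mono2) (auto simp: frontier_inv_def intro!: divide_nonneg_nonneg mult_nonneg_nonneg max_est_nonneg)
  finally have "real (expansion_cost S) \<le> (\<Sum>u\<in>pverts G. real (card (in_nbs G u)) / \<epsilon>\<^sub>r * max_est t u)" .
  moreover have "(\<Sum>w\<in>pverts G. real (card (in_nbs G w) + 1) * ((est S w - res S w) / (\<alpha> * (\<beta> * \<epsilon>\<^sub>r))))
      \<le> (\<Sum>w\<in>pverts G. real (card (in_nbs G w) + 1) * (max_est t w / (\<alpha> * (\<beta> * \<epsilon>\<^sub>r))))"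
  proof (intro sum_mono mult_left_mono divide_right_mono)
    fix w assume "w \<in> pverts G"
    then show "est S w - res S w \<le> max_est t w"
      using inv est_le_max_est[OF S, of w] by (simp add: frontier_inv_def add_increasing2 diff_le_eq)
  qed (use pos in auto)
  ultimately have "real (ops S) \<le>
      (\<Sum>w\<in>pverts G. real (card (in_nbs G w) + 1) * (max_est t w / (\<alpha> * (\<beta> * \<epsilon>\<^sub>r)))) +
      (\<Sum>u\<in>pverts G. real (card (in_nbs G u)) / \<epsilon>\<^sub>r * max_est t u)"
    using inv by (simp add: frontier_inv_def)
  also have "\<dots> = frontier_cost t"
    unfolding frontier_cost_def sum.distrib[symmetric] by (intro sum.cong) (auto simp: algebra_simps)
  finally show ?thesis .
qed

text \<open>After exchanging the two sums, the coefficient of each \<open>w\<close> is multiplied by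
  the sum of \<open>max_est t w\<close> over all targets, which is at most \<open>1\<close>.\<close>

lemma sum_frontier_cost_le:
  "(\<Sum>t\<in>pverts G. frontier_cost t) \<le> (2 / \<beta> + 1) * (real (card (parcs G)) / (\<alpha> * \<epsilon>\<^sub>r))"
proof -
  define m where "m = real (card (parcs G))"
  define a where "a = (\<lambda>w. real (card (in_nbs G w) + 1) / (\<alpha> * (\<beta> * \<epsilon>\<^sub>r)) + real (card (in_nbs G w)) / \<epsilon>\<^sub>r)"
  have a: "0 \<le> a w" for w
    using alpha beta eps by (simp add: a_def)
  have "(\<Sum>t\<in>pverts G. frontier_cost t) = (\<Sum>w\<in>pverts G. a w * (\<Sum>t\<in>pverts G. max_est t w))"
    unfolding frontier_cost_def a_def sum_distrib_left by (rule sum.swap)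
  also have "\<dots> \<le> (\<Sum>w\<in>pverts G. a w * 1)"
    using a by (intro sum_mono mult_left_mono sum_max_est_le_1) auto
  also have "\<dots> = (m + real (card (pverts G))) / (\<alpha> * (\<beta> * \<epsilon>\<^sub>r)) + m / \<epsilon>\<^sub>r"
    unfolding a_def m_def sum_card_in_nbs[symmetric]
    by (simp add: sum.distrib sum_divide_distrib add_divide_distrib)
  \<comment> \<open>Bounding the vertex count by \<open>m\<close> produces
    \<open>2 / \<beta>\<close>; the factor \<open>1 / \<alpha>\<close> put into the last term lets
    it contribute the \<open>+ 1\<close>.\<close>
  also have "\<dots> \<le> (m + m) / (\<alpha> * (\<beta> * \<epsilon>\<^sub>r)) + m / (\<alpha> * \<epsilon>\<^sub>r)"
  proof (intro add_mono divide_right_mono divide_left_mono)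
    show "real (card (pverts G)) \<le> m"
      unfolding m_def using card_verts_le_card_arcs out_degree_pos by auto
  qed (use alpha beta eps in \<open>auto simp: m_def\<close>)
  also have "\<dots> = (2 / \<beta> + 1) * (m / (\<alpha> * \<epsilon>\<^sub>r))"
    using alpha beta eps by (simp add: field_simps)
  finally show ?thesis
    by (simp add: m_def)
qed

section \<open>Average running time\<close>

lemma fast_ppr_time_le:
  "fast_ppr_time G \<alpha> \<beta> \<epsilon>\<^sub>r k s t \<le> ennreal (frontier_cost t + real k / \<alpha>)"
  unfolding fast_ppr_time_def reachable_def[symmetric]
proof (rule SUP_least)
  fix S assume S: "S \<in> reachable t"
  have "of_nat (ops S) + ennreal (real k / \<alpha>) = ennreal (real (ops S) + real k / \<alpha>)"
    using alpha by (simp add: ennreal_of_nat_eq_real_of_nat)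
  also have "\<dots> \<le> ennreal (frontier_cost t + real k / \<alpha>)"
    using ops_reachable_le[OF S] by (intro ennreal_leI) simp
  finally have *: "of_nat (ops S) + ennreal (real k / \<alpha>) \<le> ennreal (frontier_cost t + real k / \<alpha>)" .
  show "(if frontier_done G \<alpha> \<beta> \<epsilon>\<^sub>r S
      then \<integral>\<^sup>+ x. of_nat (snd x) \<partial>measure_pmf (fast_ppr_finish G \<alpha> k s S) else of_nat (ops S))
      \<le> ennreal (frontier_cost t + real k / \<alpha>)"
    using order_trans[OF nn_integral_fast_ppr_finish_le[OF alpha, of G k s S] *]
      order_trans[OF _ *, of "of_nat (ops S)"]
    by (simp add: add_increasing2)
qed

text \<open>The bound for a pair is independent of \<open>s\<close>, so only the average over
  \<open>t\<close> matters; it divides the arc count by the vertex count and so produces the average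
  degree.\<close>

lemma fast_ppr_average_time_le:
  assumes "pverts G \<noteq> {}"
  shows "fast_ppr_average_time G \<alpha> \<beta> \<epsilon>\<^sub>r k
    \<le> ennreal ((2 / \<beta> + 1) * (average_degree G / (\<alpha> * \<epsilon>\<^sub>r)) + real k / \<alpha>)"
proof -
  define n where "n = real (card (pverts G))"
  have n: "0 < n"
    using assms pair_finite_verts by (simp add: n_def card_gt_0_iff)
  have cost: "0 \<le> frontier_cost t + real k / \<alpha>" for t
    using frontier_cost_nonneg alpha by simp
  have "fast_ppr_average_time G \<alpha> \<beta> \<epsilon>\<^sub>r k
      \<le> (\<integral>\<^sup>+ (s, t). ennreal (frontier_cost t + real k / \<alpha>)
          \<partial>measure_pmf (pmf_of_set (pverts G \<times> pverts G)))"
    unfolding fast_ppr_average_time_def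
    by (intro nn_integral_mono) (auto simp: fast_ppr_time_le split: prod.splits)
  also have "\<dots> = (\<Sum>(s, t)\<in>pverts G \<times> pverts G. ennreal (frontier_cost t + real k / \<alpha>)) /
      of_nat (card (pverts G \<times> pverts G))"
    using assms pair_finite_verts by (subst nn_integral_pmf_of_set) auto
  also have "\<dots> = ennreal ((\<Sum>(s, t)\<in>pverts G \<times> pverts G. frontier_cost t + real k / \<alpha>) / (n * n))"
    using n cost
    by (subst divide_ennreal[symmetric])
       (auto simp: case_prod_unfold sum_nonneg n_def card_cartesian_product
         ennreal_of_nat_eq_real_of_nat)
  also have "(\<Sum>(s, t)\<in>pverts G \<times> pverts G. frontier_cost t + real k / \<alpha>)
      = n * ((\<Sum>t\<in>pverts G. frontier_cost t) + n * (real k / \<alpha>))"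
    by (simp add: sum.cartesian_product[symmetric] sum.distrib n_def)
  also have "\<dots> / (n * n) = (\<Sum>t\<in>pverts G. frontier_cost t) / n + real k / \<alpha>"
    using n by (simp add: field_simps)
  also have "(\<Sum>t\<in>pverts G. frontier_cost t) / n
      \<le> (2 / \<beta> + 1) * (real (card (parcs G)) / (\<alpha> * \<epsilon>\<^sub>r)) / n"
    using n by (intro divide_right_mono sum_frontier_cost_le) simp
  also have "\<dots> = (2 / \<beta> + 1) * (average_degree G / (\<alpha> * \<epsilon>\<^sub>r))"
    by (simp add: average_degree_def n_def)
  finally show ?thesis
    by (simp add: ennreal_leI)
qed

lemma average_degree_ge_1:
  assumes "pverts G \<noteq> {}"
  shows "1 \<le> average_degree G"
  using card_verts_le_card_arcs out_degree_pos assms pair_finite_verts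
  by (simp add: average_degree_def le_divide_eq card_gt_0_iff)

end

section \<open>Rounding of the number of walks and the final constant\<close>

text \<open>Rounding up adds at most \<open>1\<close>, which
  \<open>d / \<epsilon> + \<epsilon> / \<delta>\<close> absorbs: if
  \<open>\<epsilon> \<le> 1\<close> the first term is at least \<open>1\<close>, otherwise
  \<open>\<delta> \<le> 1 < \<epsilon>\<close> and the second one is.\<close>

lemma number_of_walks_le:
  fixes c d \<epsilon> \<delta> :: real
  assumes "0 \<le> c" "0 < \<epsilon>" "0 < \<delta>" "1 \<le> d"
    and k: "k = nat \<lfloor>c * \<epsilon> / \<delta>\<rfloor> \<or> (k = nat \<lceil>c * \<epsilon> / \<delta>\<rceil> \<and> (\<epsilon> \<le> 1 \<or> \<delta> \<le> 1))"
  shows "real k \<le> (c + 1) * (d / \<epsilon> + \<epsilon> / \<delta>)"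
proof -
  define x where "x = c * \<epsilon> / \<delta>"
  have x: "0 \<le> x"
    using assms by (simp add: x_def)
  have pos: "0 \<le> d / \<epsilon>" "0 \<le> \<epsilon> / \<delta>"
    using assms by auto
  have "real k \<le> x + (d / \<epsilon> + \<epsilon> / \<delta>)"
  proof (cases "k = nat \<lfloor>x\<rfloor>")
    case True
    then have "real k \<le> x"
      using x by simp
    then show ?thesis
      using pos by linarith
  next
    case False
    then have ceil: "k = nat \<lceil>x\<rceil>" and small: "\<epsilon> \<le> 1 \<or> \<delta> \<le> 1"
      using k by (auto simp: x_def)
    have "1 \<le> d / \<epsilon> + \<epsilon> / \<delta>"
    proof (cases "\<epsilon> \<le> 1")
      case True
      then have "1 \<le> d / \<epsilon>"
        using assms by (simp add: le_divide_eq)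
      then show ?thesis
        using pos by linarith
    next
      case False
      then have "1 \<le> \<epsilon> / \<delta>"
        using assms small by (simp add: le_divide_eq)
      then show ?thesis
        using pos by linarith
    qed
    moreover have "real k \<le> x + 1"
      using ceil x by linarith
    ultimately show ?thesis by linarith
  qed
  also have "x \<le> c * (d / \<epsilon> + \<epsilon> / \<delta>)"
    using mult_left_mono[of "\<epsilon> / \<delta>" "d / \<epsilon> + \<epsilon> / \<delta>" c] pos assms(1) by (simp add: x_def)
  finally show ?thesis
    by (simp only: distrib_right mult_1)
qed

theorem theorem2:
  fixes c \<beta> :: real
  assumes "c > 0" and "\<beta> > 0"
  shows "\<exists>C>0. \<forall>(G :: 'v pair_pre_digraph) (\<alpha>::real) (\<epsilon>\<^sub>r::real) (\<delta>::real) (k::nat).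
           pair_fin_digraph G \<longrightarrow> pverts G \<noteq> {} \<longrightarrow>
           (\<forall>v\<in>pverts G. out_degree (with_proj G) v \<ge> 1) \<longrightarrow>
           0 < \<alpha> \<longrightarrow> \<alpha> < 1 \<longrightarrow> \<epsilon>\<^sub>r > 0 \<longrightarrow> \<delta> > 0 \<longrightarrow>
           k = nat \<lfloor>c * \<epsilon>\<^sub>r / \<delta>\<rfloor> \<or> (k = nat \<lceil>c * \<epsilon>\<^sub>r / \<delta>\<rceil> \<and> (\<epsilon>\<^sub>r \<le> 1 \<or> \<delta> \<le> 1)) \<longrightarrow>
           fast_ppr_average_time G \<alpha> \<beta> \<epsilon>\<^sub>r k
             \<le> ennreal (C * ((1 / \<alpha>) * (average_degree G / \<epsilon>\<^sub>r + \<epsilon>\<^sub>r / \<delta>)))"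
proof (intro exI[of _ "2 / \<beta> + c + 2"] conjI allI impI)
  show "0 < 2 / \<beta> + c + 2"
    using assms by (simp add: add_pos_pos)
next
  fix G :: "'v pair_pre_digraph" and \<alpha> \<epsilon>\<^sub>r \<delta> :: real and k :: nat
  assume G: "pair_fin_digraph G" "pverts G \<noteq> {}" "\<forall>v\<in>pverts G. out_degree (with_proj G) v \<ge> 1"
    and pos: "0 < \<alpha>" "\<alpha> < 1" "\<epsilon>\<^sub>r > 0" "\<delta> > 0"
    and k: "k = nat \<lfloor>c * \<epsilon>\<^sub>r / \<delta>\<rfloor> \<or> (k = nat \<lceil>c * \<epsilon>\<^sub>r / \<delta>\<rceil> \<and> (\<epsilon>\<^sub>r \<le> 1 \<or> \<delta> \<le> 1))"
  interpret pair_fin_digraph G by (rule G(1))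
  interpret frontier_procedure G \<alpha> \<beta> \<epsilon>\<^sub>r
    using G pos assms by unfold_locales auto
  define X where "X = average_degree G / \<epsilon>\<^sub>r + \<epsilon>\<^sub>r / \<delta>"
  have walks: "real k \<le> (c + 1) * X"
    unfolding X_def using number_of_walks_le[OF _ pos(3,4) average_degree_ge_1[OF G(2)] k] assms by simp
  \<comment> \<open>The reverse phase contributes \<open>2 / \<beta> + 1\<close> and the walks
    \<open>c + 1\<close>; their sum is the chosen constant.\<close>
  have "(2 / \<beta> + 1) * (average_degree G / \<epsilon>\<^sub>r) + real k \<le> (2 / \<beta> + 1) * X + (c + 1) * X"
    using walks assms pos by (intro add_mono mult_left_mono) (auto simp: X_def)
  also have "\<dots> = (2 / \<beta> + c + 2) * X"
    by (simp add: algebra_simps)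
  finally have "((2 / \<beta> + 1) * (average_degree G / \<epsilon>\<^sub>r) + real k) / \<alpha> \<le> (2 / \<beta> + c + 2) * X / \<alpha>"
    using pos by (intro divide_right_mono) auto
  then have "(2 / \<beta> + 1) * (average_degree G / (\<alpha> * \<epsilon>\<^sub>r)) + real k / \<alpha>
      \<le> (2 / \<beta> + c + 2) * ((1 / \<alpha>) * X)"
    by (simp add: add_divide_distrib mult.commute)
  then show "fast_ppr_average_time G \<alpha> \<beta> \<epsilon>\<^sub>r k
      \<le> ennreal ((2 / \<beta> + c + 2) * ((1 / \<alpha>) * (average_degree G / \<epsilon>\<^sub>r + \<epsilon>\<^sub>r / \<delta>)))"
    using fast_ppr_average_time_le[OF G(2), of k] order_trans ennreal_leI unfolding X_def by blast
qed

end
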